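(* Let $X_1,X_2,\ldots,X_n$ be independent and identically distributed one-dimensional (real-valued) random variables with a continuous positive density function $f$. Let $S=\big(\sum_{i=1}^n X_i^2\big)^{1/2}$. Then the random vector $$\left(\frac{X_1}{S},\frac{X_2}{S},\ldots,\frac{X_n}{S}\right)$$ has a uniform distribution on the unit sphere $\mathbb{S}^{n-1}\subset\mathbb{R}^n$ if and only if each $X_i$ is a normal random variable with zero mean.
   Context: The uniform distribution on $\mathbb{S}^{n-1}$ is the normalized surface measure. Since the $X_i$ have a density, $S>0$ almost surely, so the vector is defined almost surely.
   Formalization: The theorem is stated for n ≥ 3: the equivalence fails for n = 1 (any even density gives a uniform sign) and for n = 2 (the density √2/(π(1+x⁴)) gives a uniform direction but is not normal). *)

theory Defs
  imports "HOL-Probability.Probability"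
begin

text \<open>
  Surface measure on the unit sphere, as a Borel measure on the ambient space that is concentrated
  on \<open>sphere 0 1\<close>. As in the usual construction through polar coordinates, a Borel set \<open>A\<close> of unit
  vectors gets the mass \<open>n * vol {r *\<^sub>R u | u \<in> A, 0 < r < 1}\<close>, where \<open>n\<close> is the dimension. For \<open>x \<noteq> 0\<close>,
  \<open>sgn x\<close> is the unit vector \<open>x /\<^sub>R norm x\<close>.
\<close>

definition sphere_surface_measure :: "'a::euclidean_space measure" where
  "sphere_surface_measure =
     scale_measure (of_nat DIM('a)) (distr (restrict_space lborel (ball 0 1 - {0})) borel sgn)"

definition uniform_on_sphere :: "'a::euclidean_space measure" where
  "uniform_on_sphere = uniform_measure sphere_surface_measure (sphere 0 1)"

lemma sets_sphere_surface_measure [simp]: "sets sphere_surface_measure = sets borel"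
  by (simp add: sphere_surface_measure_def)

lemma sets_uniform_on_sphere [simp]: "sets uniform_on_sphere = sets borel"
  by (simp add: uniform_on_sphere_def)

lemma emeasure_sphere_surface_measure:
  fixes A :: "'a::euclidean_space set"
  assumes [measurable]: "A \<in> sets borel"
  shows "emeasure sphere_surface_measure A =
    of_nat DIM('a) * emeasure lborel {x. 0 < norm x \<and> norm x < 1 \<and> sgn x \<in> A}"
proof -
  have m: "sgn \<in> restrict_space lborel (ball 0 1 - {0}) \<rightarrow>\<^sub>M (borel :: 'a measure)"
    by (rule measurable_restrict_space1) simp
  have eq: "sgn -` A \<inter> (ball 0 1 - {0}) = {x. 0 < norm x \<and> norm x < 1 \<and> sgn x \<in> A}"
    by auto
  have "emeasure (restrict_space lborel (ball 0 1 - {0})) (sgn -` A \<inter> (ball 0 1 - {0})) =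
      emeasure lborel {x. 0 < norm x \<and> norm x < 1 \<and> sgn x \<in> A}"
    by (subst emeasure_restrict_space) (auto simp: eq)
  then show ?thesis
    by (simp add: sphere_surface_measure_def emeasure_distr[OF m] space_restrict_space)
qed

lemma emeasure_sphere_surface_measure_sphere:
  "emeasure sphere_surface_measure (sphere (0::'a::euclidean_space) 1) =
    of_nat DIM('a) * ennreal (unit_ball_vol DIM('a))"
proof -
  have "{x::'a. 0 < norm x \<and> norm x < 1 \<and> sgn x \<in> sphere 0 1} = ball 0 1 - {0}"
    by (auto simp: norm_sgn)
  moreover have "emeasure lborel (ball (0::'a) 1 - {0}) = emeasure lborel (ball (0::'a) 1)"
    by (rule emeasure_Diff_null_set) auto
  ultimately show ?thesis
    by (simp add: emeasure_sphere_surface_measure emeasure_ball)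
qed

lemma prob_space_uniform_on_sphere:
  "prob_space (uniform_on_sphere :: 'a::euclidean_space measure)"
  unfolding uniform_on_sphere_def
proof (rule prob_space_uniform_measure)
  show "emeasure sphere_surface_measure (sphere (0::'a) 1) \<noteq> 0"
    using unit_ball_vol_pos[of "real DIM('a)"]
    by (simp add: not_le emeasure_sphere_surface_measure_sphere ennreal_eq_0_iff)
  show "emeasure sphere_surface_measure (sphere (0::'a) 1) \<noteq> \<infinity>"
    by (simp add: emeasure_sphere_surface_measure_sphere ennreal_mult_eq_top_iff)
qed

text \<open>
  The factor \<open>n\<close> makes this the surface area proper: it is the limit of the volume of the thin shell
  over \<open>A\<close> divided by the thickness of the shell.
\<close>

lemma emeasure_cone_scale:
  fixes A :: "'a::euclidean_space set"
  assumes [measurable]: "A \<in> sets borel" and R: "R > 0"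
  shows "emeasure lborel {x. 0 < norm x \<and> norm x < R \<and> sgn x \<in> A} =
    ennreal (R ^ DIM('a)) * emeasure lborel {x. 0 < norm x \<and> norm x < 1 \<and> sgn x \<in> A}"
    (is "emeasure _ ?C = _")
proof -
  have "emeasure lborel ?C =
      emeasure (density (distr lborel borel (\<lambda>x. 0 + R *\<^sub>R x)) (\<lambda>_. \<bar>R\<bar> ^ DIM('a))) ?C"
    using R by (subst lborel_affine[of R 0]) auto
  also have "\<dots> = ennreal (R ^ DIM('a)) * emeasure (distr lborel borel (\<lambda>x. R *\<^sub>R x)) ?C"
    using R by (simp add: emeasure_density_const)
  also have "emeasure (distr lborel borel (\<lambda>x. R *\<^sub>R x)) ?C =
      emeasure lborel {x. 0 < norm x \<and> norm x < 1 \<and> sgn x \<in> A}"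
    using R by (subst emeasure_distr) (auto intro!: arg_cong[where f = "emeasure lborel"]
        simp: sgn_scaleR)
  finally show ?thesis .
qed

lemma sphere_surface_measure_shell:
  fixes A :: "'a::euclidean_space set"
  assumes [measurable]: "A \<in> sets borel"
  shows "((\<lambda>h. measure lborel {x. 1 \<le> norm x \<and> norm x < 1 + h \<and> sgn x \<in> A} / h)
    \<longlongrightarrow> measure sphere_surface_measure A) (at_right 0)"
proof -
  define C where "C R = {x. 0 < norm x \<and> norm x < R \<and> sgn x \<in> A}" for R :: real
  have [measurable]: "C R \<in> sets borel" for R
    unfolding C_def by measurable
  have fin: "emeasure lborel (C R) \<noteq> \<infinity>" for R
  proof -
    have "emeasure lborel (C R) \<le> emeasure lborel (ball (0::'a) R)"
      by (rule emeasure_mono) (auto simp: C_def)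
    then show ?thesis
      using emeasure_lborel_ball_finite[of "0::'a" R] by auto
  qed
  have C: "measure lborel (C R) = R ^ DIM('a) * measure lborel (C 1)" if "R > 0" for R
    using emeasure_cone_scale[of A R] that by (simp add: measure_def C_def enn2real_mult)
  have shell: "measure lborel {x. 1 \<le> norm x \<and> norm x < 1 + h \<and> sgn x \<in> A} / h =
      ((1 + h) ^ DIM('a) - 1 ^ DIM('a)) / h * measure lborel (C 1)" if "h > 0" for h
  proof -
    have "{x. 1 \<le> norm x \<and> norm x < 1 + h \<and> sgn x \<in> A} = C (1 + h) - C 1"
      using that by (auto simp: C_def)
    moreover have "measure lborel (C (1 + h) - C 1) = measure lborel (C (1 + h)) - measure lborel (C 1)"
      using fin that by (intro measure_Diff) (auto simp: C_def)
    ultimately show ?thesis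
      using C[of "1 + h"] that by (simp add: field_simps)
  qed
  have "((\<lambda>R::real. R ^ DIM('a)) has_real_derivative real DIM('a)) (at 1)"
    by (auto intro!: derivative_eq_intros)
  then have "((\<lambda>h. ((1 + h) ^ DIM('a) - 1 ^ DIM('a)) / h) \<longlongrightarrow> real DIM('a)) (at (0::real))"
    by (simp add: DERIV_def)
  then have "((\<lambda>h. ((1 + h) ^ DIM('a) - 1 ^ DIM('a)) / h * measure lborel (C 1))
      \<longlongrightarrow> real DIM('a) * measure lborel (C 1)) (at_right (0::real))"
    by (intro tendsto_intros) (rule tendsto_within_subset, auto)
  moreover have "real DIM('a) * measure lborel (C 1) = measure sphere_surface_measure A"
    by (simp add: measure_def emeasure_sphere_surface_measure C_def enn2real_mult)
  moreover have "\<forall>\<^sub>F h in at_right 0. h > (0::real)"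
    by (rule eventually_at_right_less)
  ultimately show ?thesis
    by (auto elim!: Lim_transform_eventually eventually_mono simp: shell)
qed

end

theory Submission
  imports Defs
begin

text \<open>
  The level sets of the Gaussian density are balls, so the direction of a Gaussian vector is uniform.
  Conversely, the direction determines the ratios of the coordinates. On the event that three
  coordinates are positive, put \<open>Y\<^sub>i = ln X\<^sub>i\<close>; the joint law of \<open>(Y\<^sub>1 - Y\<^sub>3, Y\<^sub>2 - Y\<^sub>3)\<close> is then the same as
  for standard normal coordinates. By Kotlarski's lemma this determines the law of \<open>Y\<^sub>i\<close> up to a
  translation, that is, \<open>f\<close> on the positive half-line up to a scaling. The lemma needs the
  characteristic function of \<open>Y\<^sub>i\<close> in the Gaussian case to have no zeros; up to a nonvanishing factor
  it is \<open>\<Gamma>((1 + i s) / 2)\<close>. The same holds on the negative half-line, and continuity of \<open>f\<close> at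
  \<open>0\<close> forces the two scales to agree.
\<close>

section \<open>Random vectors with independent coordinates\<close>

text \<open>Rectangles determine a product measure, and on them Tonelli splits the integral of a
  product of one-variable functions.\<close>

lemma density_PiM_prod:
  fixes f :: "'i \<Rightarrow> 'b \<Rightarrow> ennreal"
  assumes "finite I" "product_sigma_finite M" "product_sigma_finite (\<lambda>i. density (M i) (f i))"
    and f [measurable]: "\<And>i. f i \<in> borel_measurable (M i)"
  shows "density (PiM I M) (\<lambda>x. \<Prod>i\<in>I. f i (x i)) = PiM I (\<lambda>i. density (M i) (f i))"
proof -
  interpret M: product_sigma_finite M by fact
  interpret D: product_sigma_finite "\<lambda>i. density (M i) (f i)" by fact
  show ?thesis
  proof (rule D.PiM_eqI)
    show "sets (density (PiM I M) (\<lambda>x. \<Prod>i\<in>I. f i (x i))) = sets (PiM I (\<lambda>i. density (M i) (f i)))"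
      by (auto intro!: sets_PiM_cong)
    fix B assume "\<And>i. i \<in> I \<Longrightarrow> B i \<in> sets (density (M i) (f i))"
    then have B [measurable]: "\<And>i. i \<in> I \<Longrightarrow> B i \<in> sets (M i)" by simp
    have m: "(\<lambda>x. f i (x i)) \<in> borel_measurable (PiM I M)" if "i \<in> I" for i
      using that by measurable
    have "emeasure (density (PiM I M) (\<lambda>x. \<Prod>i\<in>I. f i (x i))) (Pi\<^sub>E I B) =
        (\<integral>\<^sup>+x. (\<Prod>i\<in>I. f i (x i)) * indicator (Pi\<^sub>E I B) x \<partial>PiM I M)"
      using \<open>finite I\<close> B m by (intro emeasure_density borel_measurable_prod_ennreal
          sets_PiM_I_finite) auto
    also have "\<dots> = (\<integral>\<^sup>+x. (\<Prod>i\<in>I. f i (x i) * indicator (B i) (x i)) \<partial>PiM I M)"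
      using \<open>finite I\<close> by (intro nn_integral_cong)
        (auto simp: prod.distrib indicator_def space_PiM PiE_iff extensional_def)
    also have "\<dots> = (\<Prod>i\<in>I. \<integral>\<^sup>+x. f i x * indicator (B i) x \<partial>M i)"
      using \<open>finite I\<close> by (intro M.product_nn_integral_prod) auto
    also have "\<dots> = (\<Prod>i\<in>I. emeasure (density (M i) (f i)) (B i))"
      by (intro prod.cong refl) (simp add: emeasure_density)
    finally show "emeasure (density (PiM I M) (\<lambda>x. \<Prod>i\<in>I. f i (x i))) (Pi\<^sub>E I B) =
        (\<Prod>i\<in>I. emeasure (density (M i) (f i)) (B i))" .
  qed fact
qed

lemma borel_measurable_vec_lambda [measurable (raw)]:
  fixes g :: "'n::finite \<Rightarrow> 'b \<Rightarrow> real"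
  assumes [measurable]: "\<And>i. g i \<in> borel_measurable M"
  shows "(\<lambda>x. \<chi> i. g i x) \<in> borel_measurable M"
  by (subst borel_measurable_euclidean_space) (auto simp: Basis_vec_def inner_axis)

lemma borel_measurable_vec_nth [measurable (raw)]:
  fixes g :: "'b \<Rightarrow> real ^ 'n"
  assumes [measurable]: "g \<in> borel_measurable M"
  shows "(\<lambda>x. g x $ i) \<in> borel_measurable M"
  by (simp add: cart_eq_inner_axis)

text \<open>Boxes determine Lebesgue measure. This carries the product structure from functions on a
  finite index type over to \<open>real ^ 'n\<close>, where \<open>norm\<close> and
  \<open>sgn\<close> live.\<close>

lemma lborel_eq_distr_PiM_vec:
  "(lborel :: (real ^ 'n) measure) = distr (\<Pi>\<^sub>M i\<in>UNIV. lborel) borel (\<lambda>x. \<chi> i. x i)"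
proof (rule lborel_eqI)
  interpret product_sigma_finite "\<lambda>_::'n. lborel :: real measure"
    by standard
  fix l u :: "real ^ 'n"
  assume "\<And>b. b \<in> Basis \<Longrightarrow> l \<bullet> b \<le> u \<bullet> b"
  then have le: "l $ i \<le> u $ i" for i
    by (simp add: cart_eq_inner_axis)
  have m: "(\<lambda>x. \<chi> i. x i) \<in> PiM (UNIV::'n set) (\<lambda>_. lborel :: real measure) \<rightarrow>\<^sub>M borel"
    by (intro borel_measurable_vec_lambda) measurable
  have "(\<lambda>x. \<chi> i. x i) -` box l u \<inter> space (PiM UNIV (\<lambda>_. lborel)) =
      Pi\<^sub>E UNIV (\<lambda>i. {l $ i<..<u $ i})"
    by (auto simp: mem_box_cart space_PiM PiE_iff)
  then have "emeasure (distr (PiM UNIV (\<lambda>_. lborel)) borel (\<lambda>x. \<chi> i. x i)) (box l u) =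
      (\<Prod>i\<in>UNIV. emeasure lborel {l $ i<..<u $ i})"
    by (simp add: emeasure_distr[OF m] emeasure_PiM)
  also have "\<dots> = ennreal (\<Prod>i\<in>UNIV. u $ i - l $ i)"
    using le by (simp add: prod_ennreal)
  also have "(\<Prod>i\<in>UNIV. u $ i - l $ i) = (\<Prod>b\<in>Basis. (u - l) \<bullet> b)"
  proof -
    have B: "Basis = (\<lambda>i. axis i (1::real)) ` (UNIV :: 'n set)"
      by (auto simp: Basis_vec_def)
    have "inj (\<lambda>i::'n. axis i (1::real))"
      by (auto simp: inj_on_def axis_eq_axis)
    then show ?thesis
      unfolding B by (simp add: prod.reindex inner_axis)
  qed
  finally show "emeasure (distr (PiM UNIV (\<lambda>_. lborel)) borel (\<lambda>x. \<chi> i. x i)) (box l u) =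
      (\<Prod>b\<in>Basis. (u - l) \<bullet> b)" .
qed simp

text \<open>By independence the law of the tuple is the product of the marginals; pushing it forward
  to \<open>real ^ 'n\<close> takes the product density along.\<close>

lemma (in prob_space) distr_vec_indep_density:
  fixes X :: "'n::finite \<Rightarrow> 'a \<Rightarrow> real"
  assumes indep: "indep_vars (\<lambda>_. borel) X UNIV"
    and X: "\<And>i. distributed M lborel (X i) g"
  shows "distr M borel (\<lambda>\<omega>. \<chi> i. X i \<omega>) = density lborel (\<lambda>x. \<Prod>i\<in>UNIV. g (x $ i))"
proof -
  have [measurable]: "X i \<in> borel_measurable M" for i
    using distributed_measurable[OF X[of i]] by simp
  have g [measurable]: "g \<in> borel_measurable borel"
    using distributed_borel_measurable[OF X[of undefined]] by simp
  have D: "distr M borel (X i) = density lborel g" for i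
    using distributed_distr_eq_density[OF X[of i]] by (simp cong: distr_cong)
  have "prob_space (density lborel g)"
    using prob_space_distr[of "X undefined" borel] by (simp add: D)
  then interpret P: product_prob_space "\<lambda>_::'n. density lborel g"
    by (simp add: product_prob_space_def product_prob_space_axioms_def product_sigma_finite_def
        prob_space_imp_sigma_finite)
  have psf: "product_sigma_finite (\<lambda>_::'n. lborel :: real measure)"
    by standard
  have vec [measurable]: "(\<lambda>x::'n \<Rightarrow> real. \<chi> i. x i) \<in> PiM UNIV (\<lambda>_. borel) \<rightarrow>\<^sub>M borel"
    by (intro borel_measurable_vec_lambda) measurable
  have lb: "sets (PiM (UNIV::'n set) (\<lambda>_. lborel :: real measure)) = sets (PiM UNIV (\<lambda>_. borel))"
    by (intro sets_PiM_cong) auto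
  have [measurable]: "(\<lambda>\<omega>. \<lambda>i\<in>UNIV. X i \<omega>) \<in> M \<rightarrow>\<^sub>M PiM UNIV (\<lambda>_. borel)"
    by (intro measurable_restrict) simp
  have "distr M borel (\<lambda>\<omega>. \<chi> i. X i \<omega>) =
      distr (distr M (PiM UNIV (\<lambda>_. borel)) (\<lambda>\<omega>. \<lambda>i\<in>UNIV. X i \<omega>)) borel (\<lambda>x. \<chi> i. x i)"
    by (subst distr_distr) (simp_all add: comp_def, simp add: restrict_def)
  also have "distr M (PiM UNIV (\<lambda>_. borel)) (\<lambda>\<omega>. \<lambda>i\<in>UNIV. X i \<omega>) = PiM UNIV (\<lambda>_. density lborel g)"
    using indep_vars_iff_distr_eq_PiM[where I = UNIV and X = X and M' = "\<lambda>_. borel"] indep by (simp add: D)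
  also have "PiM (UNIV::'n set) (\<lambda>_. density lborel g) =
      density (PiM UNIV (\<lambda>_. lborel)) (\<lambda>x. \<Prod>i\<in>UNIV. g (x i))"
    using psf P.product_sigma_finite_axioms by (intro density_PiM_prod[symmetric]) auto
  also have "distr \<dots> borel (\<lambda>x. \<chi> i. x i) =
      density (distr (PiM UNIV (\<lambda>_. lborel)) borel (\<lambda>x. \<chi> i. x i)) (\<lambda>x. \<Prod>i\<in>UNIV. g (x $ i))"
    by (subst density_distr)  (auto simp: measurable_cong_sets[OF lb refl])
  finally show ?thesis
    by (simp add: lborel_eq_distr_PiM_vec)
qed

section \<open>Directions of Gaussian vectors\<close>

text \<open>This avoids computing normalising constants: between probability measures,
  proportionality to the volumes of truncated cones already fixes \<open>K\<close>.\<close>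

lemma eq_uniform_on_sphereI:
  fixes Q :: "'a::euclidean_space measure"
  assumes "prob_space Q" and sets: "sets Q = sets borel"
    and Q: "\<And>A. A \<in> sets borel \<Longrightarrow>
      emeasure Q A = K * emeasure lborel {x. 0 < norm x \<and> norm x < 1 \<and> sgn x \<in> A}"
  shows "Q = uniform_on_sphere"
proof (rule measure_eqI)
  let ?C = "\<lambda>A. emeasure lborel {x::'a. 0 < norm x \<and> norm x < 1 \<and> sgn x \<in> A}"
  interpret Q: prob_space Q by fact
  interpret U: prob_space "uniform_on_sphere :: 'a measure"
    by (rule prob_space_uniform_on_sphere)
  fix A assume "A \<in> sets Q"
  then have [measurable]: "A \<in> sets borel" by (simp add: sets)
  define d where "d = (of_nat DIM('a) :: ennreal)"
  define v where "v = ?C UNIV"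
  have d: "d \<noteq> 0" "d \<noteq> \<top>" by (auto simp: d_def ennreal_of_nat_eq_real_of_nat)
  have sph: "sgn x \<in> sphere 0 1 \<inter> B \<longleftrightarrow> sgn x \<in> B" if "0 < norm x" for x :: 'a and B
    using that by (auto simp: norm_sgn)
  have C: "?C (sphere 0 1 \<inter> B) = ?C B" for B :: "'a set"
    using sph by (metis (lifting))
  \<comment> \<open>Total mass one determines \<open>K\<close> and also excludes that the volume
    \<open>v\<close> is zero or infinite.\<close>
  have 1: "K * v = 1"
    using Q[of UNIV] Q.emeasure_space_1 sets_eq_imp_space_eq[OF sets] by (simp add: v_def)
  have v: "v \<noteq> 0" "v \<noteq> \<top>"
    using 1 by (auto simp: ennreal_mult_top split: if_splits)
  have K: "K = 1 / v"
    using 1 v by (metis ennreal_mult_divide_eq)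
  have "emeasure uniform_on_sphere A = d * ?C A / (d * v)"
    using C[of A] C[of UNIV]
    by (simp add: uniform_on_sphere_def emeasure_sphere_surface_measure d_def v_def)
  also have "\<dots> = ?C A / v"
    using divide_mult_eq[of d "?C A" v] d by (simp add: mult.commute)
  also have "\<dots> = K * ?C A"
    by (simp add: K divide_ennreal_def mult.commute)
  finally show "emeasure Q A = emeasure uniform_on_sphere A"
    by (simp add: Q)
qed (simp add: sets)

lemma normal_density_prod:
  fixes x :: "real ^ 'n"
  shows "(\<Prod>i\<in>UNIV. normal_density 0 \<sigma> (x $ i)) =
    (1 / sqrt (2 * pi * \<sigma>\<^sup>2)) ^ CARD('n) * exp (- (norm x)\<^sup>2 / (2 * \<sigma>\<^sup>2))"
proof -
  have "(norm x)\<^sup>2 = (\<Sum>i\<in>UNIV. (x $ i)\<^sup>2)"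
    by (simp add: norm_vec_def L2_set_def sum_nonneg)
  then show ?thesis
    by (simp add: normal_density_def prod_dividef power_divide sum_divide_distrib sum_negf
        flip: exp_sum)
qed

text \<open>The superlevel sets of a Gaussian density are balls centred at the origin, so by the layer cake
  formula the mass of a cone is a mixture of volumes of truncated cones.\<close>

lemma emeasure_gaussian_cone:
  fixes A :: "'a::euclidean_space set"
  assumes [measurable]: "A \<in> sets borel" and "c > 0" "\<sigma> > 0"
  shows "emeasure (density lborel (\<lambda>x. ennreal (c * exp (- (norm x)\<^sup>2 / (2 * \<sigma>\<^sup>2)))))
      {x::'a. x \<noteq> 0 \<and> sgn x \<in> A} =
    (\<integral>\<^sup>+t\<in>{0<..<c}. ennreal (sqrt (2 * \<sigma>\<^sup>2 * ln (c / t)) ^ DIM('a)) \<partial>lborel) *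
    emeasure lborel {x::'a. 0 < norm x \<and> norm x < 1 \<and> sgn x \<in> A}"
proof -
  define g where "g x = c * exp (- (norm x)\<^sup>2 / (2 * \<sigma>\<^sup>2))" for x :: 'a
  \<comment> \<open>For \<open>0 < t < c\<close>, this is the radius of the ball on which the
    density exceeds \<open>t\<close>.\<close>
  define R where "R t = sqrt (2 * \<sigma>\<^sup>2 * ln (c / t))" for t
  define V where "V = emeasure lborel {x::'a. 0 < norm x \<and> norm x < 1 \<and> sgn x \<in> A}"
  have g_pos: "g x > 0" and g_le: "g x \<le> c" for x
    using \<open>c > 0\<close> by (auto simp: g_def)
  have [measurable]: "g \<in> borel_measurable borel" unfolding g_def by measurable
  have level: "0 < t \<and> t < g x \<longleftrightarrow> 0 < t \<and> t < c \<and> norm x < R t" for t x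
  proof (cases "0 < t \<and> t < c")
    case True
    then have "norm x < R t \<longleftrightarrow> (norm x)\<^sup>2 < 2 * \<sigma>\<^sup>2 * ln (c / t)"
      unfolding R_def by (metis norm_ge_zero real_less_rsqrt real_sqrt_less_iff real_sqrt_abs abs_norm_cancel)
    also have "\<dots> \<longleftrightarrow> (norm x)\<^sup>2 / (2 * \<sigma>\<^sup>2) < ln c - ln t"
      using True \<open>\<sigma> > 0\<close> by (simp add: ln_div field_simps)
    also have "\<dots> \<longleftrightarrow> ln t < ln (g x)"
      using \<open>c > 0\<close> by (auto simp: g_def ln_mult)
    also have "\<dots> \<longleftrightarrow> t < g x"
      using True g_pos by simp
    finally show ?thesis using True by simp
  next
    case False
    then show ?thesis using g_le[of x] by auto
  qed
  \<comment> \<open>Writing the density as a length prepares the layer cake formula; Tonelli then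
    integrates over \<open>x\<close> first, at a fixed level \<open>t\<close>.\<close>
  have g_eq: "ennreal (g x) = (\<integral>\<^sup>+t. indicator {0<..<g x} t \<partial>lborel)" for x
    using g_pos[of x] by simp
  have "emeasure (density lborel (\<lambda>x. ennreal (g x))) {x. x \<noteq> 0 \<and> sgn x \<in> A} =
      (\<integral>\<^sup>+x. ennreal (g x) * indicator {x. x \<noteq> 0 \<and> sgn x \<in> A} x \<partial>lborel)"
    by (intro emeasure_density) measurable
  also have "\<dots> = (\<integral>\<^sup>+x. \<integral>\<^sup>+t. indicator {0<..<g x} t * indicator {x. x \<noteq> 0 \<and> sgn x \<in> A} x
      \<partial>lborel \<partial>lborel)"
    by (simp add: g_eq nn_integral_multc)
  also have "\<dots> = (\<integral>\<^sup>+x. \<integral>\<^sup>+t. indicator {0<..<c} t *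
      indicator {x. 0 < norm x \<and> norm x < R t \<and> sgn x \<in> A} x \<partial>lborel \<partial>lborel)"
    using level by (intro nn_integral_cong) (auto split: split_indicator)
  also have "\<dots> = (\<integral>\<^sup>+t. \<integral>\<^sup>+x. indicator {0<..<c} t *
      indicator {x. 0 < norm x \<and> norm x < R t \<and> sgn x \<in> A} x \<partial>lborel \<partial>lborel)"
    unfolding R_def by (intro lborel_pair.Fubini') measurable
  also have "\<dots> = (\<integral>\<^sup>+t. indicator {0<..<c} t *
      emeasure lborel {x. 0 < norm x \<and> norm x < R t \<and> sgn x \<in> A} \<partial>lborel)"
    by (simp add: nn_integral_cmult)
  also have "\<dots> = (\<integral>\<^sup>+t. ennreal (R t ^ DIM('a)) * indicator {0<..<c} t * V \<partial>lborel)"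
  proof (intro nn_integral_cong)
    fix t
    have "R t > 0" if "0 < t" "t < c"
      using that \<open>\<sigma> > 0\<close> by (simp add: R_def)
    then show "indicator {0<..<c} t * emeasure lborel {x. 0 < norm x \<and> norm x < R t \<and> sgn x \<in> A} =
        ennreal (R t ^ DIM('a)) * indicator {0<..<c} t * V"
      using emeasure_cone_scale[of A "R t"] by (auto simp: V_def split: split_indicator)
  qed
  also have "\<dots> = (\<integral>\<^sup>+t\<in>{0<..<c}. ennreal (R t ^ DIM('a)) \<partial>lborel) * V"
    unfolding R_def by (intro nn_integral_multc) measurable
  finally show ?thesis
    by (simp add: g_def[abs_def] R_def V_def)
qed

lemma (in prob_space) sgn_normal_vector_uniform:
  fixes X :: "'n::finite \<Rightarrow> 'a \<Rightarrow> real"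
  assumes indep: "indep_vars (\<lambda>_. borel) X UNIV" and "\<sigma> > 0"
    and X: "\<And>i. distributed M lborel (X i) (\<lambda>x. ennreal (normal_density 0 \<sigma> x))"
  shows "distr M borel (\<lambda>\<omega>. sgn (\<chi> i. X i \<omega>)) = uniform_on_sphere"
proof -
  have [measurable]: "X i \<in> borel_measurable M" for i
    using distributed_measurable[OF X[of i]] by simp
  define c where "c = (1 / sqrt (2 * pi * \<sigma>\<^sup>2)) ^ CARD('n)"
  have "c > 0" using \<open>\<sigma> > 0\<close> by (simp add: c_def)
  define P where "P = distr M borel (\<lambda>\<omega>. \<chi> i. X i \<omega>)"
  have P: "P = density lborel (\<lambda>x. ennreal (c * exp (- (norm x)\<^sup>2 / (2 * \<sigma>\<^sup>2))))"
    unfolding P_def by (subst distr_vec_indep_density[OF indep X])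
      (simp add: prod_ennreal normal_density_prod c_def)
  interpret P: prob_space P
    unfolding P_def by (intro prob_space_distr) measurable
  have "distr P borel sgn = uniform_on_sphere"
  proof (rule eq_uniform_on_sphereI)
    show "prob_space (distr P borel sgn)"
      by (intro P.prob_space_distr) (simp add: P)
    fix A :: "(real ^ 'n) set"
    assume [measurable]: "A \<in> sets borel"
    have "emeasure (distr P borel sgn) A = emeasure P {x. sgn x \<in> A}"
      by (subst emeasure_distr) (auto simp: P vimage_def)
    also have "\<dots> = emeasure P {x. x \<noteq> 0 \<and> sgn x \<in> A}"
    proof (intro emeasure_eq_AE)
      \<comment> \<open>As \<open>sgn 0 = 0\<close>, the origin may lie in the preimage of
        \<open>A\<close>, but it belongs to no truncated cone; it has mass zero.\<close>
      have "AE x in P. x \<noteq> 0"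
        unfolding P by (subst AE_density) (auto intro: eventually_mono[OF AE_lborel_singleton[of 0]])
      then show "AE x in P. x \<in> {x. sgn x \<in> A} \<longleftrightarrow> x \<in> {x. x \<noteq> 0 \<and> sgn x \<in> A}"
        by (rule eventually_mono) simp
    qed (simp_all add: P)
    \<comment> \<open>The first factor does not depend on \<open>A\<close>; it is the constant
      \<open>K\<close> of \<open>eq_uniform_on_sphereI\<close>.\<close>
    also have "\<dots> = (\<integral>\<^sup>+t\<in>{0<..<c}. ennreal (sqrt (2 * \<sigma>\<^sup>2 * ln (c / t)) ^ DIM(real ^ 'n)) \<partial>lborel) *
        emeasure lborel {x. 0 < norm x \<and> norm x < 1 \<and> sgn x \<in> A}"
      unfolding P using \<open>c > 0\<close> \<open>\<sigma> > 0\<close> by (intro emeasure_gaussian_cone) auto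
    finally show "emeasure (distr P borel sgn) A = \<dots>" .
  qed simp
  then show ?thesis
    by (simp add: P_def distr_distr comp_def)
qed

section \<open>Kotlarski's lemma\<close>

text \<open>Integrating \<open>r (s + t) = r s * r t\<close> over \<open>t\<close> in an interval on which the integral of \<open>r\<close> does not
  vanish shows that \<open>r\<close> is differentiable with \<open>r' = k * r\<close>.\<close>

lemma continuous_character_real:
  fixes r :: "real \<Rightarrow> complex"
  assumes cont: "continuous_on UNIV r" and mult: "\<And>s t. r (s + t) = r s * r t"
    and norm: "\<And>s. norm (r s) = 1"
  obtains a where "\<And>s. r s = exp (\<i> * of_real (a * s))"
proof -
  have translate: "((\<lambda>x. g (x + c)) has_vector_derivative g') (at x)"
    if "(g has_vector_derivative g') (at (x + c))" for g :: "real \<Rightarrow> complex" and g' c x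
    using vector_diff_chain_at[of "\<lambda>x. x + c" 1 x g g'] that
    by (simp add: comp_def has_vector_derivative_add_const has_vector_derivative_id)
  have r0: "r 0 = 1"
    using mult[of 0 0] norm[of 0] by auto
  have contI: "continuous_on I r" for I
    using cont continuous_on_subset by blast
  define F where "F x = integral {0..x} r" for x
  have F: "(F has_vector_derivative r x) (at x)" if "x > 0" for x
  proof -
    have "((\<lambda>u. integral {0..u} r) has_vector_derivative r x) (at x within {0..x+1})"
      using that by (intro integral_has_vector_derivative contI) auto
    moreover have "at x within {0..x+1} = at x"
      using that by (intro at_within_interior) (auto simp: interior_atLeastAtMost_real)
    ultimately show ?thesis by (simp add: F_def[abs_def])
  qed
  \<comment> \<open>If \<open>F\<close> vanished at all positive arguments, so would its derivative
    \<open>r\<close>, which has modulus 1.\<close>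
  have "\<exists>c>0. F c \<noteq> 0"
  proof (rule ccontr)
    assume "\<not> ?thesis"
    then have F0: "F x = 0" if "x > 0" for x using that by auto
    have "((\<lambda>_. 0) has_vector_derivative r 1) (at 1)"
      by (rule has_vector_derivative_transform_within_open[OF F[of 1], of "{0<..}"]) (auto simp: F0)
    then have "r 1 = 0"
      using has_vector_derivative_const vector_derivative_unique_at by blast
    then show False using norm[of 1] by simp
  qed
  then obtain c where c: "c > 0" "F c \<noteq> 0" by auto
  have shift: "r s * F c = F (s + c) - F s" if "s > 0" for s
  proof -
    have "r s * F c = integral {0..c} (\<lambda>t. r (s + t))"
      by (simp add: F_def mult integral_mult_right)
    also have "\<dots> = integral {s..s+c} r"
      using integral_shift_Icc_real[of 0 c r s] by (simp add: comp_def add.commute)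
    also have "\<dots> = F (s + c) - F s"
      using that c Henstock_Kurzweil_Integration.integral_combine[of 0 s "s + c" r]
      by (simp add: F_def integrable_continuous_interval contI algebra_simps)
    finally show ?thesis .
  qed
  \<comment> \<open>Differentiating \<open>shift\<close> gives
    \<open>r' s * F c = r (s + c) - r s = (r c - 1) * r s\<close>, which dictates this rate.\<close>
  define k where "k = (r c - 1) / F c"
  have deriv_pos: "(r has_vector_derivative k * r s) (at s)" if "s > 0" for s
  proof -
    have "((\<lambda>s. (F (s + c) - F s) / F c) has_vector_derivative (r (s + c) - r s) / F c) (at s)"
    proof -
      have "((\<lambda>s. F (s + c)) has_vector_derivative r (s + c)) (at s)"
        using translate[OF F[of "s + c"]] that c by simp
      then show ?thesis
        by (intro has_vector_derivative_divide has_vector_derivative_diff F that)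
    qed
    moreover have "(r (s + c) - r s) / F c = k * r s"
      by (simp add: k_def mult algebra_simps)
    moreover have "r s = (F (s + c) - F s) / F c" if "s > 0" for s
      using shift[OF that] c by (simp add: field_simps)
    ultimately show ?thesis
      using that by (intro has_vector_derivative_transform_within_open[of _ _ s "{0<..}" r]) auto
  qed
  \<comment> \<open>So far the derivative is known at positive points only. Shifting by
    \<open>u\<close> reaches every \<open>s\<close>, because
    \<open>r x = r (x + u) * r (- u)\<close>.\<close>
  have deriv: "(r has_vector_derivative k * r s) (at s)" for s
  proof -
    define u where "u = 1 + \<bar>s\<bar>"
    have "((\<lambda>x. r (x + u)) has_vector_derivative k * r (s + u)) (at s)"
      by (intro translate deriv_pos) (simp add: u_def)
    then have "((\<lambda>x. r (x + u) * r (- u)) has_vector_derivative k * r (s + u) * r (- u)) (at s)"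
      by (rule has_vector_derivative_mult_left)
    moreover have "r (x + u) * r (- u) = r x" for x
      by (simp flip: mult)
    ultimately show ?thesis by (simp add: mult.assoc)
  qed
  obtain d where d: "\<And>s. r s * exp (- k * of_real s) = d"
  proof (rule has_vector_derivative_zero_constant[of UNIV "\<lambda>s. r s * exp (- k * of_real s)"])
    fix s :: real
    have "((\<lambda>s. exp (- k * of_real s)) has_vector_derivative - k * exp (- k * of_real s)) (at s)"
      by (auto intro!: derivative_eq_intros has_vector_derivative_real_field)
    from has_vector_derivative_mult[OF deriv this]
    show "((\<lambda>s. r s * exp (- k * of_real s)) has_vector_derivative 0) (at s)"
      by (simp add: algebra_simps)
  qed auto
  have r_exp: "r s = exp (k * of_real s)" for s
    using d[of s] d[of 0] r0 by (simp add: exp_minus field_simps)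
  \<comment> \<open>Modulus 1 at the single point \<open>s = 1\<close> makes \<open>exp k\<close>
    unimodular, so \<open>k\<close> is imaginary.\<close>
  have "Re k = 0"
    using norm[of 1] by (simp add: r_exp)
  then have "k = \<i> * of_real (Im k)"
    by (simp add: complex_eq_iff)
  then show ?thesis
    using that[of "Im k"] r_exp by (metis mult.assoc of_real_mult)
qed

lemma (in real_distribution) char_minus: "char M (- s) = cnj (char M s)"
  using Bochner_Integration.integral_cnj[of M "\<lambda>x. iexp (s * x)"] by (simp add: char_def exp_cnj)

text \<open>Kotlarski's lemma: \<open>char L s * char L t * char L (- s - t)\<close> is the joint characteristic function
  of \<open>Y\<^sub>1 - Y\<^sub>3\<close> and \<open>Y\<^sub>2 - Y\<^sub>3\<close> for independent \<open>Y\<^sub>i\<close> with law \<open>L\<close>, so this joint law determines \<open>L\<close> up to a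
  translation.\<close>

lemma kotlarski:
  assumes "real_distribution L" "real_distribution L'"
    and nz: "\<And>s. char L' s \<noteq> 0"
    and eq: "\<And>s t. char L s * char L t * char L (- s - t) = char L' s * char L' t * char L' (- s - t)"
  obtains a where "L = distr L' borel (\<lambda>x. x + a)"
proof -
  interpret L: real_distribution L by fact
  interpret L': real_distribution L' by fact
  define r where "r s = char L s / char L' s" for s
  have r: "r s * r t * r (- s - t) = 1" for s t
    using eq[of s t] nz by (simp add: r_def)
  have r0: "r 0 = 1"
    by (simp add: r_def L.char_zero L'.char_zero)
  have rm: "r (- s) = cnj (r s)" for s
    by (simp add: r_def L.char_minus L'.char_minus)
  \<comment> \<open>With \<open>t = 0\<close> the relation makes \<open>r (- s)\<close> the inverse
    of \<open>r s\<close>. It is also the conjugate, so \<open>r\<close> has modulus 1, and the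
    relation becomes multiplicativity.\<close>
  have rr: "r s * r (- s) = 1" for s
    using r[of s 0] r0 by simp
  have norm: "norm (r s) = 1" for s
  proof -
    have "norm (r s) ^ 2 = 1"
      using rr[of s] by (metis rm complex_norm_square of_real_eq_1_iff)
    then show ?thesis by (smt (verit) norm_ge_zero power2_eq_1_iff)
  qed
  have mult: "r (s + t) = r s * r t" for s t
    using r[of s t] rr[of "s + t"] norm[of "- s - t"]
    by (metis (no_types, lifting) add_uminus_conv_diff minus_add_distrib mult_right_cancel
        norm_zero zero_neq_one)
  have "continuous_on UNIV r"
    unfolding r_def
    by (intro continuous_on_divide continuous_at_imp_continuous_on ballI L.isCont_char L'.isCont_char nz)
  from continuous_character_real[OF this mult norm]
  obtain a where a: "\<And>s. r s = exp (\<i> * of_real (a * s))" by metis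
  \<comment> \<open>Translation by \<open>a\<close> multiplies a characteristic function by
    \<open>iexp (s * a)\<close>, so Levy's uniqueness theorem identifies the two laws.\<close>
  have "char L s = char (distr L' borel (\<lambda>x. x + a)) s" for s
  proof -
    have "char L s = iexp (s * a) * char L' s"
      using a[of s] nz[of s] by (simp add: r_def field_simps)
    also have "\<dots> = (CLINT x|L'. iexp (s * a) * iexp (s * x))"
      by (simp add: char_def)
    also have "\<dots> = (CLINT x|L'. iexp (s * (x + a)))"
      by (intro Bochner_Integration.integral_cong) (simp_all add: exp_add[symmetric] algebra_simps)
    finally show ?thesis
      by (simp add: char_def integral_distr)
  qed
  moreover have "real_distribution (distr L' borel (\<lambda>x. x + a))"
    by (intro L'.real_distribution_distr) simp
  ultimately have "L = distr L' borel (\<lambda>x. x + a)"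
    using \<open>real_distribution L\<close> by (intro Levy_uniqueness ext)
  then show ?thesis using that by blast
qed

lemma (in prob_space) integral_uniform_measure:
  fixes g :: "'a \<Rightarrow> 'b::{banach, second_countable_topology}"
  assumes [measurable]: "A \<in> sets M" "g \<in> borel_measurable M" and A: "prob A \<noteq> 0"
  shows "(\<integral>x. g x \<partial>uniform_measure M A) = (\<integral>x. indicator A x *\<^sub>R g x \<partial>M) /\<^sub>R prob A"
proof -
  have "uniform_measure M A = density M (\<lambda>x. ennreal (indicator A x / prob A))"
    unfolding uniform_measure_def emeasure_eq_measure
    using A by (intro density_cong) (auto simp: divide_ennreal[of 1, simplified] zero_less_measure_iff split: split_indicator)
  then have "(\<integral>x. g x \<partial>uniform_measure M A) = (\<integral>x. (indicator A x / prob A) *\<^sub>R g x \<partial>M)"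
    by (simp add: integral_density)
  also have "\<dots> = (\<integral>x. (1 / prob A) *\<^sub>R (indicator A x *\<^sub>R g x) \<partial>M)"
    by simp
  also have "\<dots> = (\<integral>x. indicator A x *\<^sub>R g x \<partial>M) /\<^sub>R prob A"
    by (subst integral_scaleR_right) (simp add: divide_inverse)
  finally show ?thesis .
qed

section \<open>Mellin transforms on the half-line\<close>

text \<open>For \<open>x > 0\<close>, this is the complex power \<open>x\<^bsup>is\<^esup>\<close>.\<close>

definition pos_char :: "real \<Rightarrow> real \<Rightarrow> complex" where
  "pos_char s x = indicator {0<..} x *\<^sub>R iexp (s * ln x)"

lemma pos_char_measurable [measurable]: "pos_char s \<in> borel_measurable borel"
  unfolding pos_char_def[abs_def] by measurable

lemma norm_pos_char_le: "norm (pos_char s x) \<le> 1"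
  by (auto simp: pos_char_def split: split_indicator)

lemma pos_char_mult:
  assumes "c > 0"
  shows "pos_char s (c * x) = iexp (s * ln c) * pos_char s x"
  using assms by (auto simp: pos_char_def zero_less_mult_iff ln_mult ring_distribs exp_add
      split: split_indicator)

text \<open>The function under the integral is homogeneous of degree \<open>0\<close>, hence determined by the direction
  of the vector.\<close>

lemma (in prob_space) integral_pos_char_direction:
  fixes X :: "'n::finite \<Rightarrow> 'a \<Rightarrow> real"
  assumes indep: "indep_vars (\<lambda>_. borel) X UNIV"
    and D: "\<And>i. distr M borel (X i) = D"
    and ijk: "i \<noteq> j" "i \<noteq> k" "j \<noteq> k"
  shows "(\<integral>v. pos_char s (v $ i) * pos_char t (v $ j) * pos_char (- s - t) (v $ k)
      \<partial>distr M borel (\<lambda>\<omega>. sgn (\<chi> i. X i \<omega>))) =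
    (\<integral>x. pos_char s x \<partial>D) * (\<integral>x. pos_char t x \<partial>D) * (\<integral>x. pos_char (- s - t) x \<partial>D)"
proof -
  have [measurable]: "X i \<in> borel_measurable M" for i
    using indep by (simp add: indep_vars_def)
  define G where "G v = pos_char s (v $ i) * pos_char t (v $ j) * pos_char (- s - t) (v $ k)"
    for v :: "real ^ 'n"
  \<comment> \<open>Independence is applied to one family indexed by \<open>{i, j, k}\<close>, so
    the three exponents are packed into a function of the index; this needs the indices to be
    distinct.\<close>
  define c where "c = (\<lambda>_::'n. 0)(i := s, j := t, k := - s - t)"
  have [measurable]: "G \<in> borel_measurable borel"
    unfolding G_def[abs_def] by measurable
  have G_sgn: "G (sgn v) = G v" for v
  proof (cases "v = 0")
    case False
    define d where "d = inverse (norm v)"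
    have d: "d > 0" using False by (simp add: d_def)
    \<comment> \<open>The exponents sum to zero, so the powers of the common scale \<open>d\<close>
      cancel.\<close>
    have "iexp (s * ln d) * iexp (t * ln d) * iexp ((- s - t) * ln d) = 1"
      by (simp add: exp_add[symmetric] algebra_simps)
    then show ?thesis
      using d by (simp add: sgn_div_norm G_def pos_char_mult flip: d_def) algebra
  qed simp
  have "(\<integral>v. G v \<partial>distr M borel (\<lambda>\<omega>. sgn (\<chi> i. X i \<omega>))) = (\<integral>\<omega>. G (\<chi> i. X i \<omega>) \<partial>M)"
    by (simp add: integral_distr G_sgn)
  also have "\<dots> = (\<integral>\<omega>. (\<Prod>l\<in>{i, j, k}. pos_char (c l) (X l \<omega>)) \<partial>M)"
    using ijk by (simp add: G_def c_def mult.assoc)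
  also have "\<dots> = (\<Prod>l\<in>{i, j, k}. \<integral>\<omega>. pos_char (c l) (X l \<omega>) \<partial>M)"
  proof (rule indep_vars_lebesgue_integral)
    show "indep_vars (\<lambda>_. borel) (\<lambda>l \<omega>. pos_char (c l) (X l \<omega>)) {i, j, k}"
      using indep_vars_compose2[OF indep_vars_subset[OF indep, of "{i, j, k}"], of "\<lambda>l. pos_char (c l)"]
      by simp
    show "integrable M (\<lambda>\<omega>. pos_char (c l) (X l \<omega>))" for l
      by (rule integrable_const_bound[of _ 1]) (auto simp: norm_pos_char_le)
  qed simp
  also have "\<dots> = (\<Prod>l\<in>{i, j, k}. \<integral>x. pos_char (c l) x \<partial>D)"
    by (intro prod.cong refl, subst D[symmetric], subst integral_distr) auto
  also have "\<dots> = (\<integral>x. pos_char s x \<partial>D) * (\<integral>x. pos_char t x \<partial>D) * (\<integral>x. pos_char (- s - t) x \<partial>D)"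
    using ijk by (simp add: c_def mult.assoc)
  finally show ?thesis by (simp add: G_def)
qed

text \<open>The substitution \<open>u = x\<^sup>2 / 2\<close> turns the Gaussian integral over the
  positive half-line into Euler's integral for \<open>Gamma z\<close> with
  \<open>Re z = 1 / 2\<close>, and the Gamma function has no zeros.\<close>

lemma integral_pos_char_std_normal_nonzero:
  "(\<integral>x. pos_char s x \<partial>std_normal_distribution) \<noteq> 0"
proof -
  define z where "z = (1 + \<i> * of_real s) / 2"
  define f where "f u = complex_of_real u powr (z - 1) / of_real (exp u)" for u :: real
  \<comment> \<open>The root undoes the normalisation of the normal density; the exponential is 2 to
    the power \<open>1 - z\<close>, from the denominator of \<open>x\<^sup>2 / 2\<close>.\<close>
  define C where "C = sqrt (2 * pi) *\<^sub>R exp ((1 - z) * of_real (ln 2))"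
  have powr_of_real_eq_exp: "complex_of_real y powr w = exp (w * of_real (ln y))" if "y > 0" for y w
    using that by (simp add: powr_def Ln_of_real)
  have "Re z > 0" by (simp add: z_def)
  have f_cont: "isCont f u" if "u > 0" for u
    unfolding f_def[abs_def] using that by (intro continuous_intros) (auto simp: complex_nonpos_Reals_iff)
  then have [measurable]: "(\<lambda>u. indicator {0<..} u *\<^sub>R f u) \<in> borel_measurable borel"
    by (intro borel_measurable_continuous_on_indicator continuous_at_imp_continuous_on) auto
  have f_int: "set_integrable lborel {0<..} f"
    using absolutely_integrable_Gamma_integral'[OF \<open>Re z > 0\<close>]
    unfolding set_integrable_def f_def[abs_def, symmetric]
    by (subst (asm) integrable_completion) auto
  \<comment> \<open>The factor \<open>x\<close> is the derivative of \<open>x\<^sup>2 / 2\<close>.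
    Since \<open>2 * (z - 1) = \<i> * s - 1\<close>, it leaves exactly the power with exponent
    \<open>\<i> * s\<close>.\<close>
  have f_sub: "x *\<^sub>R f (x\<^sup>2 / 2) = C * (std_normal_density x *\<^sub>R pos_char s x)" if "x > 0" for x
  proof -
    have "complex_of_real (x\<^sup>2 / 2) powr (z - 1) = exp ((z - 1) * of_real (2 * ln x - ln 2))"
    proof -
      have "complex_of_real (x\<^sup>2 / 2) powr (z - 1) = exp ((z - 1) * of_real (ln (x\<^sup>2 / 2)))"
        using that by (intro powr_of_real_eq_exp) simp
      also have "ln (x\<^sup>2 / 2) = 2 * ln x - ln 2"
        using that by (simp add: ln_div ln_realpow)
      finally show ?thesis .
    qed
    also have "(z - 1) * of_real (2 * ln x - ln 2) =
        \<i> * of_real (s * ln x) + of_real (- ln x) + (1 - z) * of_real (ln 2)"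
      by (simp add: z_def algebra_simps)
    also have "exp \<dots> = iexp (s * ln x) * of_real (inverse x) * exp ((1 - z) * of_real (ln 2))"
      using that by (simp only: exp_add exp_of_real) (simp add: exp_minus)
    finally show ?thesis
      using that by (simp add: f_def C_def pos_char_def std_normal_density_def exp_minus scaleR_conv_of_real
          field_simps exp_of_real)
  qed
  interpret N: prob_space std_normal_distribution
    by (rule prob_space_normal_density) simp
  have "integrable std_normal_distribution (pos_char s)"
    by (rule N.integrable_const_bound[of _ 1]) (auto simp: norm_pos_char_le)
  then have "integrable lborel (\<lambda>x. std_normal_density x *\<^sub>R pos_char s x)"
    by (simp add: integrable_density)
  then have "integrable lborel (\<lambda>x. C * (std_normal_density x *\<^sub>R pos_char s x))"
    by (rule integrable_mult_right)
  moreover have pos: "indicator {0<..} x *\<^sub>R (x *\<^sub>R f (x\<^sup>2 / 2)) = C * (std_normal_density x *\<^sub>R pos_char s x)" for x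
    using f_sub[of x] by (auto simp: pos_char_def split: split_indicator)
  ultimately have sub_int: "set_integrable lborel {0<..} (\<lambda>x. x *\<^sub>R f (x\<^sup>2 / 2))"
    by (simp add: set_integrable_def)
  have "(LBINT u=0..\<infinity>. f u) = (LBINT x=0..\<infinity>. x *\<^sub>R f (x\<^sup>2 / 2))"
  proof (rule interval_integral_substitution_integrable)
    show "((ereal \<circ> (\<lambda>x. x\<^sup>2 / 2) \<circ> real_of_ereal) \<longlongrightarrow> 0) (at_right 0)"
      unfolding zero_ereal_def ereal_tendsto_simps
      by (rule tendsto_eq_intros | simp)+
    show "((ereal \<circ> (\<lambda>x. x\<^sup>2 / 2) \<circ> real_of_ereal) \<longlongrightarrow> \<infinity>) (at_left \<infinity>)"
      unfolding ereal_tendsto_simps by real_asymp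
    show "((\<lambda>x. x\<^sup>2 / 2) has_real_derivative x) (at x)" for x :: real
      by (auto intro!: derivative_eq_intros)
    show "isCont f (x\<^sup>2 / 2)" if "0 < ereal x" for x
      using that by (intro f_cont) auto
  qed (use sub_int f_int in \<open>simp_all add: zero_ereal_def\<close>)
  then have "(LBINT u:{0<..}. f u) = (LBINT x:{0<..}. x *\<^sub>R f (x\<^sup>2 / 2))"
    by (simp add: interval_lebesgue_integral_0_infty)
  also have "\<dots> = C * (\<integral>x. pos_char s x \<partial>std_normal_distribution)"
    unfolding set_lebesgue_integral_def pos by (simp add: integral_density del: mult_scaleR_right)
  finally have "C * (\<integral>x. pos_char s x \<partial>std_normal_distribution) = integral {0<..} f"
    using set_borel_integral_eq_integral(2)[OF f_int] by simp
  also have "\<dots> = Gamma z"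
    using Gamma_integral_complex'[OF \<open>Re z > 0\<close>] by (simp add: f_def[abs_def] integral_unique)
  also have "\<dots> \<noteq> 0"
  proof -
    have "z \<notin> \<int>\<^sub>\<le>\<^sub>0"
      using \<open>Re z > 0\<close> by (auto elim!: nonpos_Ints_cases)
    then show ?thesis by (simp add: Gamma_eq_zero_iff)
  qed
  finally show ?thesis by auto
qed

section \<open>Densities determined by the direction\<close>

text \<open>The points of \<open>U\<close> where two continuous functions differ form an open set,
  and a nonempty open set is not null.\<close>

lemma continuous_AE_eq:
  fixes f g :: "real \<Rightarrow> real"
  assumes "AE x in lborel. x \<in> U \<longrightarrow> f x = g x" "open U" "continuous_on U f" "continuous_on U g"
    and "x \<in> U"
  shows "f x = g x"
proof (rule ccontr)
  assume "f x \<noteq> g x"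
  define V where "V = U \<inter> (\<lambda>x. f x - g x) -` (- {0})"
  have "open V"
    unfolding V_def using assms by (intro continuous_open_preimage continuous_intros) auto
  moreover have "x \<in> V"
    using \<open>f x \<noteq> g x\<close> \<open>x \<in> U\<close> by (simp add: V_def)
  moreover have "emeasure lborel V = 0"
  proof -
    have "AE x in lborel. x \<notin> V"
      by (rule AE_mp[OF assms(1)]) (auto simp: V_def)
    from emeasure_eq_0_AE[OF this] show ?thesis by simp
  qed
  ultimately show False
    using open_not_negligible[of V] by (auto simp: negligible_iff_emeasure0 emeasure_completion)
qed

text \<open>It serves to realise independent standard normal variables as the coordinates of a
  product space.\<close>

lemma indep_vars_PiM_components:
  assumes D: "\<And>i. i \<in> I \<Longrightarrow> prob_space (D i)"
  shows "prob_space.indep_vars (PiM I D) D (\<lambda>i \<omega>. \<omega> i) I"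
proof -
  interpret prob_space "PiM I D"
    by (intro prob_space_PiM D)
  show ?thesis
  proof (cases "I = {}")
    case True
    show ?thesis
      unfolding indep_vars_def indep_sets_def by (auto simp: True)
  next
    case False
    have "distr (PiM I D) (PiM I D) (\<lambda>\<omega>. \<lambda>i\<in>I. \<omega> i) = distr (PiM I D) (PiM I D) (\<lambda>\<omega>. \<omega>)"
      by (intro distr_cong) (auto simp: space_PiM PiE_restrict)
    moreover have "(\<Pi>\<^sub>M i\<in>I. distr (PiM I D) (D i) (\<lambda>\<omega>. \<omega> i)) = PiM I D"
      using D by (intro PiM_cong) (auto simp: distr_PiM_component)
    ultimately show ?thesis
      using False by (subst indep_vars_iff_distr_eq_PiM') auto
  qed
qed

text \<open>Nothing is computed from \<open>uniform_on_sphere\<close> itself: standard normal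
  coordinates on an auxiliary product space have the same directional law, so only two families of
  Mellin integrals are compared.\<close>

lemma (in prob_space) uniform_direction_half_line:
  fixes X :: "'n::finite \<Rightarrow> 'a \<Rightarrow> real"
  assumes n: "CARD('n) \<ge> 3"
    and indep: "indep_vars (\<lambda>_. borel) X UNIV"
    and X: "\<And>i. distributed M lborel (X i) (\<lambda>x. ennreal (f x))"
    and cont: "continuous_on UNIV f" and pos: "\<And>x. f x > 0"
    and unif: "distr M borel (\<lambda>\<omega>. sgn (\<chi> i. X i \<omega>)) = uniform_on_sphere"
  obtains \<sigma> where "\<sigma> > 0" "\<And>x. x > 0 \<Longrightarrow> f x = normal_density 0 \<sigma> x"
proof -
  obtain i j k :: 'n where ijk: "i \<noteq> j" "i \<noteq> k" "j \<noteq> k"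
  proof -
    obtain T :: "'n set" where "card T = 3"
      using n obtain_subset_with_card_n by metis
    then show ?thesis
      using that by (auto simp: card_3_iff)
  qed
  define D where "D = density lborel (\<lambda>x. ennreal (f x))"
  let ?N = "std_normal_distribution"
  let ?P = "{0<..} :: real set"
  have XD: "distr M borel (X i) = D" for i
    using distributed_distr_eq_density[OF X[of i]] by (simp add: D_def cong: distr_cong)
  have [measurable]: "X i \<in> borel_measurable M" for i
    using distributed_measurable[OF X[of i]] by simp
  have [measurable]: "f \<in> borel_measurable borel"
    by (rule borel_measurable_continuous_onI[OF cont])
  interpret D: prob_space D
    unfolding XD[of i, symmetric] by (rule prob_space_distr) simp
  interpret N: prob_space ?N
    by (rule prob_space_normal_density) simp
  have sets [measurable_cong, simp]: "sets D = sets borel" "sets ?N = sets borel"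
    and space [simp]: "space D = UNIV" "space ?N = UNIV"
    by (simp_all add: D_def)
  interpret G: prob_space "PiM (UNIV :: 'n set) (\<lambda>_. ?N)"
    by (intro prob_space_PiM N.prob_space_axioms)
  have G_indep: "G.indep_vars (\<lambda>_. borel) (\<lambda>i \<omega>. \<omega> i) UNIV"
    using indep_vars_PiM_components[of "UNIV :: 'n set" "\<lambda>_. ?N"] N.prob_space_axioms
    by (simp add: G.indep_vars_def cong: measurable_cong_sets)
  have GN: "distr (PiM (UNIV :: 'n set) (\<lambda>_. ?N)) borel (\<lambda>\<omega>. \<omega> i) = ?N" for i
    using distr_PiM_component[of UNIV "\<lambda>_::'n. ?N" i] N.prob_space_axioms
    by (simp cong: distr_cong)
  have G_dist: "distributed (PiM (UNIV :: 'n set) (\<lambda>_. ?N)) lborel (\<lambda>\<omega>. \<omega> i)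
      (\<lambda>x. ennreal (std_normal_density x))" for i
    using GN[of i] by (auto simp: distributed_def cong: distr_cong)
  have "distr (PiM UNIV (\<lambda>_. ?N)) borel (\<lambda>\<omega>. sgn (\<chi> i::'n. \<omega> i)) = uniform_on_sphere"
    by (rule G.sgn_normal_vector_uniform[OF G_indep zero_less_one G_dist])
  then have prod_eq: "(\<integral>x. pos_char s x \<partial>D) * (\<integral>x. pos_char t x \<partial>D) * (\<integral>x. pos_char (- s - t) x \<partial>D) =
      (\<integral>x. pos_char s x \<partial>?N) * (\<integral>x. pos_char t x \<partial>?N) * (\<integral>x. pos_char (- s - t) x \<partial>?N)" for s t
    using integral_pos_char_direction[OF indep XD ijk, of s t]
      G.integral_pos_char_direction[OF G_indep GN ijk, of s t] unif by simp

  \<comment> \<open>Conditioning on positivity needs positive mass; a positive density already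
    charges the unit interval.\<close>
  have emeasure_pos: "emeasure (density lborel (\<lambda>x. ennreal (g x))) ?P \<noteq> 0"
    if "\<And>x. g x > 0" "g \<in> borel_measurable borel" for g :: "real \<Rightarrow> real"
  proof
    assume "emeasure (density lborel (\<lambda>x. ennreal (g x))) ?P = 0"
    then have "AE x in lborel. ennreal (g x) * indicator ?P x = 0"
      using that by (simp add: emeasure_density nn_integral_0_iff_AE)
    then have "AE x in lborel. x \<notin> {0<..<1::real}"
      by (rule AE_mp) (use that(1) in \<open>auto intro!: AE_I2 simp: ennreal_eq_0_iff not_le[symmetric] split: split_indicator\<close>)
    then have "emeasure lborel {x \<in> space lborel. x \<in> {0<..<1::real}} = 0"
      by (intro emeasure_eq_0_AE) simp
    then show False by (simp del: greaterThanLessThan_iff)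
  qed
  define p where "p = D.prob ?P"
  define q where "q = N.prob ?P"
  have p: "p > 0"
    using emeasure_pos[of f] pos D.emeasure_eq_measure[of ?P]
    by (simp add: p_def D_def[symmetric] zero_less_measure_iff)
  have q: "q > 0"
    using emeasure_pos[of std_normal_density] normal_density_pos[of 1 0] N.emeasure_eq_measure[of ?P]
    by (simp add: q_def zero_less_measure_iff)
  have emeasure_p: "emeasure D ?P = ennreal p" and emeasure_q: "emeasure ?N ?P = ennreal q"
    by (simp_all only: p_def q_def D.emeasure_eq_measure N.emeasure_eq_measure)
  define L where "L = distr (uniform_measure D ?P) borel ln"
  define L' where "L' = distr (uniform_measure ?N ?P) borel ln"
  interpret U: prob_space "uniform_measure D ?P"
    using p by (intro prob_space_uniform_measure) (simp_all add: emeasure_p)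
  interpret U': prob_space "uniform_measure ?N ?P"
    using q by (intro prob_space_uniform_measure) (simp_all add: emeasure_q)
  have rd: "real_distribution L" "real_distribution L'"
    unfolding L_def L'_def by (auto intro!: U.real_distribution_distr U'.real_distribution_distr)
  \<comment> \<open>The Mellin integral is the probability of being positive times the
    characteristic function of the logarithm conditioned on positivity, the form that Kotlarski's
    lemma needs.\<close>
  have charL: "(\<integral>x. pos_char s x \<partial>D) = p * char L s" for s
    using p by (simp add: L_def char_def integral_distr D.integral_uniform_measure p_def[symmetric]
        pos_char_def scaleR_conv_of_real)
  have charL': "(\<integral>x. pos_char s x \<partial>?N) = q * char L' s" for s
    using q by (simp add: L'_def char_def integral_distr N.integral_uniform_measure q_def[symmetric]
        pos_char_def scaleR_conv_of_real)
  \<comment> \<open>At \<open>s = t = 0\<close> the product identity compares masses only. Once they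
    agree, they cancel from the identity for all \<open>s\<close> and \<open>t\<close>.\<close>
  have "complex_of_real (p ^ 3) = complex_of_real (q ^ 3)"
    using prod_eq[of 0 0] rd
    by (simp add: charL charL' real_distribution.char_zero power3_eq_cube)
  then have pq: "p = q"
    using p q by (metis less_imp_le of_real_eq_iff power_eq_iff_eq_base zero_less_numeral)
  obtain a where a: "L = distr L' borel (\<lambda>x. x + a)"
  proof (rule kotlarski[OF rd])
    show "char L' s \<noteq> 0" for s
      using integral_pos_char_std_normal_nonzero[of s] by (simp add: charL')
    show "char L s * char L t * char L (- s - t) = char L' s * char L' t * char L' (- s - t)" for s t
      using prod_eq[of s t] q by (simp add: charL charL' pq mult.assoc)
  qed
  \<comment> \<open>Translating the logarithm by \<open>a\<close> scales the variable by
    \<open>exp a\<close>.\<close>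
  define \<sigma> where "\<sigma> = exp a"
  have "\<sigma> > 0" by (simp add: \<sigma>_def)
  have exp_L: "uniform_measure D ?P = distr L borel exp"
  proof -
    \<comment> \<open>\<open>exp\<close> inverts \<open>ln\<close> on the positive half-line only,
      which carries all the mass of the conditional law.\<close>
    have "AE x in uniform_measure D ?P. exp (ln x) = x"
      by (rule AE_uniform_measureI) auto
    then have "distr (uniform_measure D ?P) borel (\<lambda>x. exp (ln x)) = distr (uniform_measure D ?P) borel (\<lambda>x. x)"
      by (intro distr_cong_AE) simp_all
    then show ?thesis
      by (simp add: L_def distr_distr comp_def distr_id2)
  qed
  have "uniform_measure D ?P = distr (uniform_measure ?N ?P) borel (\<lambda>x. exp (ln x + a))"
    unfolding exp_L unfolding a L'_def by (simp add: distr_distr comp_def)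
  also have "\<dots> = distr (uniform_measure ?N ?P) borel (\<lambda>x. \<sigma> * x)"
  proof (rule distr_cong_AE)
    show "AE x in uniform_measure ?N ?P. exp (ln x + a) = \<sigma> * x"
      by (rule AE_uniform_measureI) (auto simp: exp_add \<sigma>_def)
  qed simp_all
  finally have UD: "uniform_measure D ?P = distr (uniform_measure ?N ?P) borel (\<lambda>x. \<sigma> * x)" .
  have "distributed ?N lborel (\<lambda>x. x) (\<lambda>x. ennreal (std_normal_density x))"
    by (simp add: distributed_def distr_id2)
  from N.normal_density_affine[OF this, of \<sigma> 0] \<open>\<sigma> > 0\<close>
  have "distributed ?N lborel (\<lambda>x. \<sigma> * x) (\<lambda>x. ennreal (normal_density 0 \<sigma> x))"
    by simp
  then have scale: "distr ?N borel (\<lambda>x. \<sigma> * x) = density lborel (\<lambda>x. ennreal (normal_density 0 \<sigma> x))"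
    by (simp add: distributed_def cong: distr_cong)
  \<comment> \<open>As \<open>p = q\<close>, the normalising factors cancel, and equality of
    conditional laws becomes equality of the unconditional measures on the half-line.\<close>
  have D_eq: "emeasure D (?P \<inter> B) = emeasure (density lborel (\<lambda>x. ennreal (normal_density 0 \<sigma> x))) (?P \<inter> B)"
    if [measurable]: "B \<in> sets borel" for B
  proof -
    have [measurable]: "(\<lambda>x. \<sigma> * x) -` B \<in> sets borel"
      by (rule measurable_sets_borel[OF _ that]) simp
    have cancel: "y / ennreal q * ennreal q = y" for y
      using q by (simp add: ennreal_divide_times)
    have "emeasure D (?P \<inter> B) / p = emeasure (uniform_measure D ?P) B"
      by (simp add: emeasure_p)
    also have "\<dots> = emeasure (uniform_measure ?N ?P) ((\<lambda>x. \<sigma> * x) -` B)"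
      by (simp add: UD emeasure_distr)
    also have "\<dots> = emeasure ?N (?P \<inter> (\<lambda>x. \<sigma> * x) -` B) / q"
      by (subst emeasure_uniform_measure) (simp_all add: emeasure_q)
    also have "?P \<inter> (\<lambda>x. \<sigma> * x) -` B = (\<lambda>x. \<sigma> * x) -` (?P \<inter> B)"
      using \<open>\<sigma> > 0\<close> by (auto simp: zero_less_mult_iff)
    also have "emeasure ?N \<dots> = emeasure (distr ?N borel (\<lambda>x. \<sigma> * x)) (?P \<inter> B)"
      by (subst emeasure_distr) simp_all
    finally show ?thesis
      unfolding pq scale by (metis cancel)
  qed
  have "density lborel (\<lambda>x. ennreal (f x) * indicator ?P x) =
      density lborel (\<lambda>x. ennreal (normal_density 0 \<sigma> x) * indicator ?P x)"
  proof (rule measure_eqI)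
    fix B assume "B \<in> sets (density lborel (\<lambda>x. ennreal (f x) * indicator ?P x))"
    then have [measurable]: "B \<in> sets borel" by simp
    show "emeasure (density lborel (\<lambda>x. ennreal (f x) * indicator ?P x)) B =
        emeasure (density lborel (\<lambda>x. ennreal (normal_density 0 \<sigma> x) * indicator ?P x)) B"
      using D_eq[of B] by (simp add: D_def emeasure_density indicator_inter_arith mult.assoc)
  qed simp
  \<comment> \<open>A measure determines its density only almost everywhere; continuity extends the
    equality to every positive \<open>x\<close>.\<close>
  from sigma_finite_measure.density_unique[OF sigma_finite_lborel _ _ this]
  have "AE x in lborel. ennreal (f x) * indicator ?P x = ennreal (normal_density 0 \<sigma> x) * indicator ?P x"
    by simp
  then have ae: "AE x in lborel. x \<in> ?P \<longrightarrow> f x = normal_density 0 \<sigma> x"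
  proof (rule AE_mp, intro AE_I2 impI)
    fix x :: real
    assume "ennreal (f x) * indicator ?P x = ennreal (normal_density 0 \<sigma> x) * indicator ?P x" "x \<in> ?P"
    then show "f x = normal_density 0 \<sigma> x"
      using pos[of x] by simp
  qed
  have "continuous_on ?P f"
    using cont continuous_on_subset by blast
  moreover have "continuous_on ?P (normal_density 0 \<sigma>)"
    unfolding normal_density_def using \<open>\<sigma> > 0\<close> by (intro continuous_intros) simp_all
  ultimately show ?thesis
    by (intro that[OF \<open>\<sigma> > 0\<close>] continuous_AE_eq[OF ae]) simp_all
qed

section \<open>Reflection, and gluing the two half-lines at the origin\<close>

lemma distributed_uminus:
  fixes X :: "'a \<Rightarrow> real"
  assumes X: "distributed M lborel X g"
  shows "distributed M lborel (\<lambda>\<omega>. - X \<omega>) (\<lambda>x. g (- x))"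
proof -
  have [measurable]: "X \<in> borel_measurable M" "g \<in> borel_measurable borel"
    using distributed_measurable[OF X] distributed_borel_measurable[OF X] by simp_all
  have "distr M lborel (\<lambda>\<omega>. - X \<omega>) = distr (distr M lborel X) lborel uminus"
    by (simp add: distr_distr comp_def)
  also have "\<dots> = distr (density lborel g) lborel uminus"
    by (simp add: distributed_distr_eq_density[OF X])
  also have "\<dots> = density (distr lborel lborel uminus) (\<lambda>x. g (- x))"
    by (subst density_distr) simp_all
  also have "distr lborel lborel uminus = (lborel :: real measure)"
    using lborel_distr_uminus by (simp cong: distr_cong)
  finally show ?thesis
    by (simp add: distributed_def)
qed

text \<open>Reflection preserves Lebesgue measure and exchanges the truncated cones over
  \<open>A\<close> and over its reflection. This lets the half-line result be applied to the negated
  variables.\<close>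

lemma uniform_on_sphere_uminus:
  "distr uniform_on_sphere borel uminus = (uniform_on_sphere :: 'a::euclidean_space measure)"
proof (rule eq_uniform_on_sphereI)
  interpret prob_space "uniform_on_sphere :: 'a measure"
    by (rule prob_space_uniform_on_sphere)
  show "prob_space (distr uniform_on_sphere borel (uminus :: 'a \<Rightarrow> 'a))"
    by (intro prob_space_distr) (simp add: measurable_cong_sets[OF sets_uniform_on_sphere refl])
  let ?C = "\<lambda>A. {x::'a. 0 < norm x \<and> norm x < 1 \<and> sgn x \<in> A}"
  let ?n = "of_nat DIM('a) :: ennreal"
  fix A :: "'a set" assume [measurable]: "A \<in> sets borel"
  have [measurable]: "uminus -` A \<in> sets borel"
    by (rule measurable_sets_borel[of uminus borel]) simp_all
  \<comment> \<open>Intersecting with the sphere changes nothing, since \<open>sgn x\<close> is a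
    unit vector for every \<open>x \<noteq> 0\<close>.\<close>
  have "emeasure lborel (?C (sphere 0 1 \<inter> uminus -` A)) = emeasure (distr lborel borel uminus) (?C A)"
    by (subst emeasure_distr) (auto intro!: arg_cong[where f = "emeasure lborel"] simp: sgn_minus norm_sgn)
  also have "distr lborel borel uminus = (lborel :: 'a measure)"
    using lborel_affine[of "-1" "0::'a", symmetric] by (simp add: density_1)
  finally have C: "emeasure lborel (?C (sphere 0 1 \<inter> uminus -` A)) = emeasure lborel (?C A)" .
  have "emeasure (distr uniform_on_sphere borel uminus) A = emeasure uniform_on_sphere (uminus -` A)"
    by (subst emeasure_distr) (simp_all add: sets_eq_imp_space_eq[OF sets_uniform_on_sphere]
        measurable_cong_sets[OF sets_uniform_on_sphere refl])
  also have "\<dots> = emeasure sphere_surface_measure (sphere 0 1 \<inter> uminus -` A) /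
      emeasure sphere_surface_measure (sphere (0::'a) 1)"
    unfolding uniform_on_sphere_def by (rule emeasure_uniform_measure) simp_all
  also have "emeasure sphere_surface_measure (sphere 0 1 \<inter> uminus -` A) = ?n * emeasure lborel (?C A)"
    by (subst emeasure_sphere_surface_measure) (simp_all only: C, simp)
  finally show "emeasure (distr uniform_on_sphere borel uminus) A =
      ?n / emeasure sphere_surface_measure (sphere (0::'a) 1) * emeasure lborel (?C A)"
    by (simp add: ennreal_divide_times ennreal_times_divide)
qed simp

text \<open>The zero vector is no exception, because \<open>x / 0 = 0\<close> and
  \<open>sgn 0 = 0\<close>; so the identity holds everywhere, not just almost surely.\<close>

lemma direction_eq_sgn:
  fixes x :: "'n::finite \<Rightarrow> real"
  shows "(\<chi> i. x i / sqrt (\<Sum>j\<in>UNIV. (x j)\<^sup>2)) = sgn (\<chi> i. x i)"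
  by (simp add: vec_eq_iff sgn_div_norm norm_vec_def L2_set_def divide_inverse mult.commute)

lemma (in prob_space) uniform_direction_iid_normal:
  fixes X :: "'n::finite \<Rightarrow> 'a \<Rightarrow> real"
  assumes n: "CARD('n) \<ge> 3"
    and indep: "indep_vars (\<lambda>_. borel) X UNIV"
    and X: "\<And>i. distributed M lborel (X i) (\<lambda>x. ennreal (f x))"
    and cont: "continuous_on UNIV f" and pos: "\<And>x. f x > 0"
    and unif: "distr M borel (\<lambda>\<omega>. sgn (\<chi> i. X i \<omega>)) = uniform_on_sphere"
  obtains \<sigma> where "\<sigma> > 0" "f = normal_density 0 \<sigma>"
proof -
  have [measurable]: "X i \<in> borel_measurable M" for i
    using distributed_measurable[OF X[of i]] by simp
  obtain \<sigma> where \<sigma>: "\<sigma> > 0" "\<And>x. x > 0 \<Longrightarrow> f x = normal_density 0 \<sigma> x"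
    using uniform_direction_half_line[OF n indep X cont pos unif] by blast
  have neg: "sgn (\<chi> i. - X i \<omega>) = - sgn (\<chi> i. X i \<omega>)" for \<omega>
  proof -
    have "(\<chi> i. - X i \<omega>) = - (\<chi> i. X i \<omega>)"
      by (simp add: vec_eq_iff)
    then show ?thesis by (simp only: sgn_minus)
  qed
  have "distr M borel (\<lambda>\<omega>. sgn (\<chi> i. - X i \<omega>)) =
      distr (distr M borel (\<lambda>\<omega>. sgn (\<chi> i. X i \<omega>))) borel uminus"
    by (simp add: neg distr_distr comp_def)
  then have unif': "distr M borel (\<lambda>\<omega>. sgn (\<chi> i. - X i \<omega>)) = uniform_on_sphere"
    by (simp add: unif uniform_on_sphere_uminus)
  have indep': "indep_vars (\<lambda>_. borel) (\<lambda>i \<omega>. - X i \<omega>) UNIV"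
    using indep_vars_compose2[OF indep, of "\<lambda>_. uminus"] by simp
  have cont': "continuous_on UNIV (\<lambda>x. f (- x))"
    by (intro continuous_on_compose2[OF cont] continuous_intros) auto
  obtain \<tau> where \<tau>: "\<tau> > 0" "\<And>x. x > 0 \<Longrightarrow> f (- x) = normal_density 0 \<tau> x"
    using uniform_direction_half_line[OF n indep' distributed_uminus[OF X] cont' pos unif'] by blast
  \<comment> \<open>The general \<open>g\<close> covers both \<open>f\<close> and its reflection: by
    continuity, the right-hand limit at 0 gives the value there.\<close>
  have at0: "f 0 = normal_density 0 s 0"
    if "s > 0" "\<And>x. x > 0 \<Longrightarrow> g x = normal_density 0 s x" "continuous_on UNIV g" "g 0 = f 0" for s g
  proof (rule tendsto_unique[of "at_right (0::real)"])
    have "isCont (normal_density 0 s) 0"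
      unfolding normal_density_def using \<open>s > 0\<close> by (intro continuous_intros) simp_all
    then show "(normal_density 0 s \<longlongrightarrow> normal_density 0 s 0) (at_right 0)"
      by (auto simp: isCont_def intro: tendsto_within_subset)
    have "isCont g 0"
      using that(3) by (simp add: continuous_on_eq_continuous_at)
    then have "(g \<longlongrightarrow> f 0) (at_right 0)"
      using that(4) by (auto simp: isCont_def intro: tendsto_within_subset)
    then show "(normal_density 0 s \<longlongrightarrow> f 0) (at_right 0)"
      by (rule Lim_transform_eventually) (auto simp: eventually_at_filter that(2))
  qed simp
  have f0: "f 0 = normal_density 0 \<sigma> 0" "f 0 = normal_density 0 \<tau> 0"
    using at0[OF \<sigma> cont] at0[OF \<tau> cont'] by simp_all
  \<comment> \<open>The value at 0 is \<open>1 / sqrt (2 * pi * \<sigma>\<^sup>2)\<close>, which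
    determines a positive scale.\<close>
  then have "\<sigma> = \<tau>"
    using \<sigma>(1) \<tau>(1) by (simp add: normal_density_def real_sqrt_mult)
  have "f x = normal_density 0 \<sigma> x" for x
  proof (cases x "0 :: real" rule: linorder_cases)
    case less
    then show ?thesis
      using \<tau>(2)[of "- x"] \<open>\<sigma> = \<tau>\<close> by (simp add: normal_density_def)
  qed (use \<sigma> f0 in auto)
  then show ?thesis
    using that \<sigma>(1) by blast
qed

theorem theorem1:
  fixes M :: "'a measure"
    and X :: "'n::finite \<Rightarrow> 'a \<Rightarrow> real"
    and f :: "real \<Rightarrow> real"
    and S :: "'a \<Rightarrow> real"
  assumes M: "prob_space M"
    and n: "CARD('n) \<ge> 3"
    and indep: "prob_space.indep_vars M (\<lambda>_. borel) X UNIV"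
    and density: "\<And>i. distributed M lborel (X i) (\<lambda>x. ennreal (f x))"
    and cont: "continuous_on UNIV f"
    and pos: "\<And>x. f x > 0"
    and S: "\<And>\<omega>. S \<omega> = sqrt (\<Sum>i\<in>UNIV. (X i \<omega>)\<^sup>2)"
  shows "distr M borel (\<lambda>\<omega>. (\<chi> i. X i \<omega> / S \<omega>) :: real ^ 'n) = uniform_on_sphere
    \<longleftrightarrow> (\<forall>i. \<exists>\<sigma>>0. distributed M lborel (X i) (\<lambda>x. ennreal (normal_density 0 \<sigma> x)))"
proof -
  interpret prob_space M by (rule M)
  have dir: "(\<chi> i. X i \<omega> / S \<omega>) = sgn (\<chi> i. X i \<omega>)" for \<omega>
    unfolding S by (rule direction_eq_sgn)
  show ?thesis
    unfolding dir
  proof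
    assume "distr M borel (\<lambda>\<omega>. sgn (\<chi> i. X i \<omega>)) = uniform_on_sphere"
    from uniform_direction_iid_normal[OF n indep density cont pos this]
    obtain \<sigma> where "\<sigma> > 0" "f = normal_density 0 \<sigma>" .
    then show "\<forall>i. \<exists>\<sigma>>0. distributed M lborel (X i) (\<lambda>x. ennreal (normal_density 0 \<sigma> x))"
      using density by auto
  next
    assume "\<forall>i. \<exists>\<sigma>>0. distributed M lborel (X i) (\<lambda>x. ennreal (normal_density 0 \<sigma> x))"
    then obtain \<sigma> where \<sigma>: "\<sigma> > 0"
      "distributed M lborel (X undefined) (\<lambda>x. ennreal (normal_density 0 \<sigma> x))"
      by blast
    \<comment> \<open>The hypothesis lets the scale vary with the index, but all variables share the
      density \<open>f\<close>, so the scale of one arbitrary index serves for all.\<close>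
    have "distributed M lborel (X i) (\<lambda>x. ennreal (normal_density 0 \<sigma> x))" for i
      using \<sigma>(2) density[of i] density[of undefined] by (simp add: distributed_def)
    then show "distr M borel (\<lambda>\<omega>. sgn (\<chi> i. X i \<omega>)) = uniform_on_sphere"
      using \<sigma>(1) by (intro sgn_normal_vector_uniform[OF indep])
  qed
qed

end
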